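(* Let an A-stable Runge-Kutta method with (real) coefficients $(a_{ij})_{1\le i,j\le s}$, $(b_j)_{1\le j\le s}$ and stability function $R$ be given, and let $A\in\mathbb{R}^{d\times d}$ be such that the linear constant-coefficient ODE $\dot{y}=Ay$ is stable. Then there exists a symmetric positive definite matrix $W\in\mathbb{R}^{d\times d}$, independent of the step size, such that the numerical solution is contractive in the $W$-weighted euclidean norm: for every sequence of step sizes $h_n>0$ (constant or varying) and any two numerical solutions $(y_n)_{n\ge 0}$, $(\bar{y}_n)_{n\ge 0}$ in $\mathbb{R}^d$ computed by the method with these step sizes, that is, $y_{n+1}=R(h_nA)y_n$ and $\bar{y}_{n+1}=R(h_nA)\bar{y}_n$ for all $n\ge 0$, one has $$\|y_{n+1}-\bar{y}_{n+1}\|_W\le \|y_n-\bar{y}_n\|_W\qquad\text{for all } n\ge 0.$$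
   Context: The $s$-stage Runge-Kutta method with coefficients $a_{ij}$, $b_j$ for advancing the solution of the linear constant-coefficient ODE $\dot{y}=Ay$ from $t_n$ to $t_{n+1}=t_n+h$ is $$g_i=y_n+h\sum_{j=1}^s a_{ij}Ag_j\quad(1\le i\le s),\qquad y_{n+1}=y_n+h\sum_{j=1}^s b_jAg_j.$$ Eliminating the stage variables $g_i$ gives $y_{n+1}=R(hA)y_n$, where $R$ is the stability function of the method, i.e. the rational function $R(z)=1+z\,b^T(I-z\,a)^{-1}e$ (taken in lowest terms), with $a=(a_{ij})$, $b=(b_j)$ and $e=(1,\ldots,1)^T\in\mathbb{R}^s$. The numerical solution is the sequence generated by this recursion. The method is A-stable if $R$ has no poles in $\{z\in\mathbb{C}:\mathrm{Re}\,z\le 0\}$ and $|R(z)|\le 1$ for all $z\in\mathbb{C}$ with $\mathrm{Re}\,z\le 0$. The ODE $\dot{y}=Ay$ is stable if all of its solutions are bounded on $[0,\infty)$; equivalently, all eigenvalues of $A$ have real part $\le 0$ and those with zero real part are semisimple. For a symmetric positive definite matrix $W$, the $W$-weighted euclidean norm is $\|y\|_W=\sqrt{y^TWy}=\|W^{1/2}y\|_2$. *)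

theory Defs
  imports
    "HOL-Analysis.Analysis"
    "HOL-Computational_Algebra.Computational_Algebra"
    "HOL-Computational_Algebra.Field_as_Ring"
begin

section \<open>Stability function\<close>

text \<open>
  The rational functions over the reals are the field \<^typ>\<open>real poly fract\<close>, with indeterminate
  \<open>z = to_fract [:0, 1:]\<close>. The entries of \<open>I - z a\<close> and its inverse live in this field; the constant
  \<open>1 :: real poly fract ^ 's\<close> below is the vector \<open>e\<close> of ones.
\<close>

definition fract_var :: "real poly fract" where
  "fract_var = to_fract [:0, 1:]"

definition fract_const :: "real \<Rightarrow> real poly fract" where
  "fract_const c = to_fract [:c:]"

definition resolvent_matrix :: "real^'s^'s \<Rightarrow> real poly fract^'s^'s" where
  "resolvent_matrix a = mat 1 - map_matrix (\<lambda>c. fract_var * fract_const c) a"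

definition stability_function :: "real^'s^'s \<Rightarrow> real^'s \<Rightarrow> real poly fract" where
  "stability_function a b =
     1 + fract_var * (\<Sum>i\<in>UNIV. fract_const (b $ i) * (matrix_inv (resolvent_matrix a) *v 1) $ i)"

text \<open>The value of \<^const>\<open>matrix_inv\<close> above is a genuine inverse: \<open>det (I - z a)\<close> is \<open>1\<close> at \<open>z = 0\<close>.\<close>

lemma to_fract_prod: "to_fract (prod f S) = (\<Prod>x\<in>S. to_fract (f x))"
  by (induction S rule: infinite_finite_induct) auto

lemma invertible_resolvent_matrix: "invertible (resolvent_matrix a)"
proof -
  define M where "M = (\<chi> i j. (if i = j then 1 else 0) - [:0, a $ i $ j:])"
  have res: "resolvent_matrix a = map_matrix to_fract M"
    by (simp add: vec_eq_iff resolvent_matrix_def M_def mat_def fract_var_def fract_const_def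
        flip: to_fract_mult)
  have sgn: "of_int k = (to_fract (of_int k) :: real poly fract)" for k
    by (cases k rule: int_cases2) (auto simp: to_fract_def of_nat_fract)
  have "det (map_matrix to_fract M) = to_fract (det M)"
    unfolding det_def by (simp add: to_fract_prod sgn)
  moreover have "poly (det M) 0 = det (map_matrix (\<lambda>p. poly p 0) M)"
    unfolding det_def by (simp add: poly_sum poly_prod)
  moreover have "map_matrix (\<lambda>p. poly p 0) M = mat 1"
    by (simp add: vec_eq_iff M_def mat_def)
  ultimately have "det (resolvent_matrix a) \<noteq> 0"
    using res by auto
  then show ?thesis
    by (simp add: invertible_det_nz)
qed

text \<open>
  \<^const>\<open>quot_of_fract\<close> returns the coprime pair of numerator and (monic) denominator, so the
  poles of a rational function are exactly the complex zeros of \<open>fract_denom\<close>.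
\<close>

definition fract_num :: "real poly fract \<Rightarrow> real poly" where
  "fract_num R = fst (quot_of_fract R)"

definition fract_denom :: "real poly fract \<Rightarrow> real poly" where
  "fract_denom R = snd (quot_of_fract R)"

definition eval_fract :: "real poly fract \<Rightarrow> complex \<Rightarrow> complex" where
  "eval_fract R z =
     poly (map_poly of_real (fract_num R)) z / poly (map_poly of_real (fract_denom R)) z"

definition fract_poles :: "real poly fract \<Rightarrow> complex set" where
  "fract_poles R = {z. poly (map_poly of_real (fract_denom R)) z = 0}"

definition A_stable :: "real poly fract \<Rightarrow> bool" where
  "A_stable R \<longleftrightarrow>
     fract_poles R \<inter> {z. Re z \<le> 0} = {} \<and> (\<forall>z. Re z \<le> 0 \<longrightarrow> cmod (eval_fract R z) \<le> 1)"

section \<open>Rational functions of a matrix\<close>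

text \<open>The multiplication \<open>*\<close> of \<^typ>\<open>real^'d^'d\<close> is componentwise, so powers are formed with \<open>**\<close>.\<close>

definition poly_matrix :: "real poly \<Rightarrow> real^'d^'d \<Rightarrow> real^'d^'d" where
  "poly_matrix p M = (\<Sum>k\<le>degree p. coeff p k *\<^sub>R ((\<lambda>N. M ** N) ^^ k) (mat 1))"

text \<open>
  Meaningful when no eigenvalue of \<open>M\<close> is a pole of \<open>R\<close>, which holds for \<open>M = h A\<close> with \<open>h > 0\<close>,
  \<open>R\<close> A-stable and \<open>A\<close> stable.
\<close>

definition fract_matrix :: "real poly fract \<Rightarrow> real^'d^'d \<Rightarrow> real^'d^'d" where
  "fract_matrix R M = poly_matrix (fract_num R) M ** matrix_inv (poly_matrix (fract_denom R) M)"

section \<open>Stable linear equations, numerical solutions and weighted norms\<close>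

definition ode_solution :: "real^'d^'d \<Rightarrow> (real \<Rightarrow> real^'d) \<Rightarrow> bool" where
  "ode_solution A y \<longleftrightarrow> (\<forall>t\<ge>0. (y has_vector_derivative A *v y t) (at t within {0..}))"

definition stable_ode :: "real^'d^'d \<Rightarrow> bool" where
  "stable_ode A \<longleftrightarrow> (\<forall>y. ode_solution A y \<longrightarrow> bounded (y ` {0..}))"

definition numerical_solution ::
    "real poly fract \<Rightarrow> real^'d^'d \<Rightarrow> (nat \<Rightarrow> real) \<Rightarrow> (nat \<Rightarrow> real^'d) \<Rightarrow> bool" where
  "numerical_solution R A h y \<longleftrightarrow> (\<forall>n. y (Suc n) = fract_matrix R (h n *\<^sub>R A) *v y n)"

definition sym_pos_def :: "real^'d^'d \<Rightarrow> bool" where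
  "sym_pos_def W \<longleftrightarrow> transpose W = W \<and> (\<forall>y. y \<noteq> 0 \<longrightarrow> y \<bullet> (W *v y) > 0)"

definition weighted_norm :: "real^'d^'d \<Rightarrow> real^'d \<Rightarrow> real" where
  "weighted_norm W y = sqrt (y \<bullet> (W *v y))"

end

(*
  Only the existence of one norm is claimed, so the norm can be adapted to A. On the generalized
  eigenspace of an eigenvalue l of A, with N = A - l, the Euclidean norm whose square is the sum over k
  of (3/|Re l|)^(2k) |N^k y|^2 makes N bounded by |Re l|/3; stability gives Re l <= 0, and N = 0 if
  Re l = 0. There R(hA) equals the sum of g_k (hN)^k with g_k the Taylor coefficients of R at hl, and
  |R| <= 1 on the disc of radius h|Re l| around hl gives |g_k| (h|Re l|)^k <= 2 (1 - |g_0|). Hence, as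
  in Bohr's theorem on power series at radius 1/3,
  |R(hA)| <= |g_0| + 2 (1 - |g_0|) (1/3 + 1/9 + ...) = 1 for all h > 0. The squared norms of the
  components are summed over the eigenvalues; q_l(A), with q_l the part of the minimal polynomial
  coprime to z - l, takes the place of the spectral projection.
*)
theory Submission
  imports Defs "HOL-Complex_Analysis.Complex_Analysis"
begin

section \<open>Polynomials of a matrix\<close>

text \<open>Acting on a vector avoids forming matrix powers, and an arbitrary field lets one notion
  serve both the real matrix and its complexification.\<close>

definition poly_act :: "'a::field ^'n^'n \<Rightarrow> 'a poly \<Rightarrow> 'a^'n \<Rightarrow> 'a^'n" where
  "poly_act M p x = (\<Sum>k\<le>degree p. coeff p k *s ((*v) M ^^ k) x)"

lemma poly_act_altdef:
  assumes "degree p \<le> n"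
  shows "poly_act M p x = (\<Sum>k\<le>n. coeff p k *s ((*v) M ^^ k) x)"
  unfolding poly_act_def
  by (rule sum.mono_neutral_left) (use assms in \<open>auto simp: coeff_eq_0\<close>)

lemma matrix_vector_mult_sum_right: "M *v sum f S = (\<Sum>i\<in>S. (M :: 'a::field^'n^'n) *v f i)"
  by (induction S rule: infinite_finite_induct) (auto simp: matrix_vector_right_distrib)

lemma poly_act_0 [simp]: "poly_act M 0 x = 0"
  by (simp add: poly_act_def)

lemma poly_act_pCons [simp]: "poly_act M (pCons c p) x = c *s x + M *v poly_act M p x"
proof -
  have "poly_act M (pCons c p) x = (\<Sum>k\<le>Suc (degree p). coeff (pCons c p) k *s ((*v) M ^^ k) x)"
    by (rule poly_act_altdef) (simp add: degree_pCons_le)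
  also have "\<dots> = c *s x + M *v poly_act M p x"
    by (simp only: sum.atMost_Suc_shift)
       (simp add: poly_act_def matrix_vector_mult_sum_right vector_scalar_commute)
  finally show ?thesis .
qed

lemma poly_act_add: "poly_act M (p + q) x = poly_act M p x + poly_act M q x"
  by (induction p q rule: poly_induct2)
     (auto simp: matrix_vector_right_distrib vector_sadd_rdistrib)

lemma poly_act_smult: "poly_act M (smult c p) x = c *s poly_act M p x"
  by (induction p) (auto simp: vector_scalar_commute vector_add_ldistrib)

lemma poly_act_mult: "poly_act M (p * q) x = poly_act M p (poly_act M q x)"
  by (induction p) (auto simp: poly_act_add poly_act_smult)

lemma poly_act_vec_add: "poly_act M p (x + y) = poly_act M p x + poly_act M p y"
  by (induction p) (auto simp: matrix_vector_right_distrib vector_add_ldistrib)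

lemma poly_act_vec_0 [simp]: "poly_act M p 0 = 0"
  by (induction p) auto

lemma poly_act_vec_smult: "poly_act M p (c *s x) = c *s poly_act M p x"
  by (induction p) (auto simp: vector_scalar_commute vector_add_ldistrib mult.commute)

lemma poly_act_commute: "poly_act M p (poly_act M q x) = poly_act M q (poly_act M p x)"
  by (metis poly_act_mult mult.commute)

lemma poly_act_1 [simp]: "poly_act M 1 x = x"
  by (simp add: one_pCons)

lemma poly_act_sum: "poly_act M (sum f S) x = (\<Sum>i\<in>S. poly_act M (f i) x)"
  by (induction S rule: infinite_finite_induct) (auto simp: poly_act_add)

lemma poly_act_eigenvector:
  assumes "M *v v = c *s v"
  shows "poly_act M p v = poly p c *s v"
  by (induction p) (auto simp: vector_scalar_commute assms mult.commute
     matrix_vector_mult_scaleR vector_sadd_rdistrib)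

text \<open>This moves the step size from the matrix into the polynomial: every p(hA) becomes a
  polynomial in A itself, which commutes with all others and can be measured in a norm built from A
  alone.\<close>

lemma poly_act_pcompose_scale:
  "poly_act M (p \<circ>\<^sub>p [:0, c:]) x = poly_act (map_matrix ((*) c) M) p x"
proof (induction p)
  case (pCons a p)
  have "map_matrix ((*) c) M *v y = c *s (M *v y)" for y
    by (simp add: vec_eq_iff matrix_vector_mult_def sum_distrib_left mult.assoc)
  then show ?case using pCons
    by (simp add: pcompose_pCons poly_act_add vector_scalar_commute poly_act_smult)
qed auto

lemma norm_vector_smult: "norm (c *s x) = norm c * norm (x :: complex^'n)"
  unfolding norm_vec_def by (simp add: norm_mult L2_set_right_distrib)

section \<open>Annihilating polynomials and eigenvectors\<close>

text \<open>The powers M^0, ..., M^n, with n the real dimension of the matrix space, are n + 1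
  members of that space, so a nontrivial real combination of them vanishes.\<close>

lemma matrix_annihilating_poly:
  fixes M :: "complex^'n^'n"
  obtains p where "p \<noteq> 0" "\<And>x. poly_act M p x = 0"
proof -
  define B where "B = (\<lambda>k. matrix ((*v) M ^^ k))"
  have lin: "Vector_Spaces.linear (*s) (*s) ((*v) M ^^ k)" for k
  proof (induction k)
    case (Suc k)
    show ?case
      using Vector_Spaces.linear_compose[OF Suc.IH matrix_vector_mul_linear_gen[of M]] by (simp add: o_def)
  qed (simp add: vec.linear_id flip: id_def)
  have B: "B k *v x = ((*v) M ^^ k) x" for k x
    unfolding B_def by (rule matrix_works[OF lin])
  define n where "n = DIM(complex^'n^'n)"
  obtain u :: "nat \<Rightarrow> real" where u: "\<exists>k\<le>n. u k \<noteq> 0" "(\<Sum>k\<le>n. u k *\<^sub>R B k) = 0"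
  \<comment> \<open>\<open>dependent\<close> speaks of a set. If two powers coincide, their set has
    fewer than n + 1 elements and the dimension count fails, but the difference of the two powers is
    itself a relation.\<close>
  proof (cases "inj_on B {..n}")
    case True
    then have "card (B ` {..n}) = Suc n" by (simp add: card_image)
    then have "dependent (B ` {..n})"
      using dependent_biggerset[of "B ` {..n}"] by (simp add: n_def)
    then obtain v where "\<exists>b\<in>B ` {..n}. v b \<noteq> 0" "(\<Sum>b\<in>B ` {..n}. v b *\<^sub>R b) = 0"
      by (auto simp: dependent_finite)
    then show thesis
      using True by (intro that[of "v \<circ> B"]) (auto simp: sum.reindex)
  next
    case False
    then obtain i j where ij: "i \<le> n" "j \<le> n" "i \<noteq> j" "B i = B j"
      by (auto simp: inj_on_def)
    let ?u = "\<lambda>k. if k = i then 1 else if k = j then -1 else (0::real)"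
    have "(\<Sum>k\<le>n. ?u k *\<^sub>R B k) = (\<Sum>k\<le>n. (if k = i then B i else 0) - (if k = j then B i else 0))"
      using ij by (intro sum.cong) auto
    also have "\<dots> = 0" using ij by (simp add: sum_subtractf)
    finally show thesis using ij by (intro that[of ?u]) auto
  qed
  define p where "p = (\<Sum>k\<le>n. monom (of_real (u k) :: complex) k)"
  have coeff: "coeff p k = (if k \<le> n then of_real (u k) else 0)" for k
    by (simp add: p_def coeff_sum)
  show thesis
  proof (rule that[of p])
    show "p \<noteq> 0" using u(1) coeff by (metis coeff_0 of_real_eq_0_iff)
    fix x
    have "degree p \<le> n" by (rule degree_le) (simp add: coeff)
    then have "poly_act M p x = (\<Sum>k\<le>n. coeff p k *s ((*v) M ^^ k) x)"
      by (rule poly_act_altdef)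
    also have "\<dots> = (\<Sum>k\<le>n. u k *\<^sub>R B k) *v x"
    proof -
      have "(\<Sum>k\<in>S. u k *\<^sub>R B k) *v x = (\<Sum>k\<in>S. of_real (u k) *s (B k *v x))" for S
        by (induction S rule: infinite_finite_induct) (auto simp: matrix_vector_mult_add_rdistrib
            vec_eq_iff matrix_vector_mult_def sum_distrib_left scaleR_conv_of_real[where 'a = complex] algebra_simps sum.distrib)
      then show ?thesis by (simp add: coeff B)
    qed
    finally show "poly_act M p x = 0" using u(2) by simp
  qed
qed

lemma least_degree_poly:
  assumes "p \<noteq> 0" "P p"
  obtains q where "q \<noteq> 0" "P q" "\<And>r. r \<noteq> 0 \<Longrightarrow> P r \<Longrightarrow> degree q \<le> degree r"
  using ex_has_least_nat[of "\<lambda>q. q \<noteq> 0 \<and> P q" p degree] assms by auto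

lemma poly_act_linear_factor: "poly_act M [:-l, 1:] x = M *v x - l *s x"
  by (simp add: vec_eq_iff)

text \<open>Split a linear factor z - l off a polynomial of least degree that annihilates x. By
  minimality the cofactor does not annihilate x, and what it makes of x is killed by M - l. On such
  an eigenvector polynomials of M act as scalars, which later refutes the vanishing of a form or the
  singularity of a matrix.\<close>

lemma eigenvector_in_orbit:
  fixes M :: "complex^'n^'n"
  assumes "x \<noteq> 0"
  obtains p l where "poly_act M p x \<noteq> 0" "M *v poly_act M p x = l *s poly_act M p x"
proof -
  obtain p0 where "p0 \<noteq> 0" "poly_act M p0 x = 0"
    using matrix_annihilating_poly[of M] by metis
  then obtain p where p: "p \<noteq> 0" "poly_act M p x = 0"
    and min: "\<And>r. r \<noteq> 0 \<Longrightarrow> poly_act M r x = 0 \<Longrightarrow> degree p \<le> degree r"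
    using least_degree_poly[of p0 "\<lambda>p. poly_act M p x = 0"] by metis
  have "degree p \<noteq> 0"
  proof
    assume "degree p = 0"
    then obtain c where "p = [:c:]" by (rule degree_eq_zeroE)
    with p assms show False by auto
  qed
  then have "\<not> constant (poly p)" by (simp add: constant_degree)
  then obtain l where "poly p l = 0" using Fundamental_Theorem_Algebra.fundamental_theorem_of_algebra by blast
  then obtain q where q: "p = [:-l, 1:] * q" by (auto simp: poly_eq_0_iff_dvd)
  with p have "q \<noteq> 0" "degree p = Suc (degree q)" by (auto simp: degree_mult_eq simp del: mult_pCons_left)
  with min[of q] have "poly_act M q x \<noteq> 0" by fastforce
  moreover have "M *v poly_act M q x = l *s poly_act M q x"
    using p(2) unfolding q poly_act_mult poly_act_linear_factor by simp
  ultimately show thesis by (rule that)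
qed

section \<open>A Euclidean norm adapted to one eigenvalue\<close>

text \<open>
  For \<open>Re l = 0\<close> the weight \<open>3 / \<bar>Re l\<bar>\<close> is \<open>0\<close>; then only \<open>m \<le> 1\<close> is used, where the single
  term \<open>k = 0\<close> has weight \<open>0 ^ 0 = 1\<close>.
\<close>

definition graded_norm :: "complex^'n^'n \<Rightarrow> complex \<Rightarrow> nat \<Rightarrow> complex^'n \<Rightarrow> real" where
  "graded_norm M l m y =
     L2_set (\<lambda>k. (3 / \<bar>Re l\<bar>) ^ k * norm (poly_act M ([:-l, 1:] ^ k) y)) {..<m}"

lemma graded_norm_nonneg: "graded_norm M l m y \<ge> 0"
  by (simp add: graded_norm_def)

lemma graded_norm_0 [simp]: "graded_norm M l m 0 = 0"
  by (simp add: graded_norm_def L2_set_def)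

lemma graded_norm_smult: "graded_norm M l m (c *s y) = norm c * graded_norm M l m y"
  by (simp add: graded_norm_def poly_act_vec_smult norm_vector_smult L2_set_right_distrib mult.left_commute)

lemma graded_norm_triangle: "graded_norm M l m (x + y) \<le> graded_norm M l m x + graded_norm M l m y"
proof -
  have "graded_norm M l m (x + y) \<le> L2_set (\<lambda>k. (3 / \<bar>Re l\<bar>) ^ k * norm (poly_act M ([:-l, 1:] ^ k) x)
      + (3 / \<bar>Re l\<bar>) ^ k * norm (poly_act M ([:-l, 1:] ^ k) y)) {..<m}"
    unfolding graded_norm_def
    by (rule L2_set_mono)
       (auto simp: poly_act_vec_add distrib_left[symmetric] intro!: mult_left_mono norm_triangle_ineq)
  also have "\<dots> \<le> graded_norm M l m x + graded_norm M l m y"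
    unfolding graded_norm_def by (rule L2_set_triangle_ineq)
  finally show ?thesis .
qed

lemma graded_norm_sum: "graded_norm M l m (sum f S) \<le> (\<Sum>i\<in>S. graded_norm M l m (f i))"
  by (induction S rule: infinite_finite_induct)
     (auto intro: order_trans[OF graded_norm_triangle])

text \<open>With N = M - l, passing from y to N y shifts the list of terms by one place, at the
  price of one factor |Re l| / 3 from the weights. The term that enters at the end is zero because
  N^m y = 0. If Re l = 0, then m <= 1 and already N y = 0 or the norm is an empty sum.\<close>

lemma graded_norm_shift:
  assumes y: "poly_act M ([:-l, 1:] ^ m) y = 0" and m: "Re l = 0 \<Longrightarrow> m \<le> 1"
  shows "graded_norm M l m (poly_act M [:-l, 1:] y) \<le> \<bar>Re l\<bar> / 3 * graded_norm M l m y"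
proof (cases "Re l = 0")
  case True
  with m consider "m = 0" | "m = 1" by linarith
  then show ?thesis using y True by cases (auto simp: graded_norm_def L2_set_def)
next
  case False
  define s where "s = 3 / \<bar>Re l\<bar>"
  have s: "s > 0" "\<bar>Re l\<bar> / 3 = 1 / s" using False by (auto simp: s_def)
  define F where "F = (\<lambda>k. s ^ k * norm (poly_act M ([:-l, 1:] ^ k) y))"
  have "graded_norm M l m (poly_act M [:-l, 1:] y) = L2_set (\<lambda>k. 1 / s * F (Suc k)) {..<m}"
    unfolding graded_norm_def
    using s(1) by (intro L2_set_cong)
      (simp_all only: F_def s_def[symmetric] power_Suc2 poly_act_mult, simp add: field_simps)
  also have "\<dots> = 1 / s * L2_set (\<lambda>k. F (Suc k)) {..<m}"
    using s by (subst L2_set_right_distrib) auto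
  also have "\<dots> \<le> 1 / s * L2_set F {..<m}"
  proof (rule mult_left_mono)
    have "(\<Sum>k<m. (F (Suc k))\<^sup>2) + (F 0)\<^sup>2 = (\<Sum>k<Suc m. (F k)\<^sup>2)"
      by (subst sum.lessThan_Suc_shift) simp
    also have "\<dots> = (\<Sum>k<m. (F k)\<^sup>2)"
      using y by (simp add: F_def)
    finally show "L2_set (\<lambda>k. F (Suc k)) {..<m} \<le> L2_set F {..<m}" unfolding L2_set_def
      by (intro real_sqrt_le_mono) (smt (verit) zero_le_power2)
  qed (use s in simp)
  also have "1 / s * L2_set F {..<m} = \<bar>Re l\<bar> / 3 * graded_norm M l m y"
    by (simp only: s(2) graded_norm_def F_def s_def)
  finally show ?thesis .
qed

lemma graded_norm_power:
  assumes y: "poly_act M ([:-l, 1:] ^ m) y = 0" and m: "Re l = 0 \<Longrightarrow> m \<le> 1"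
  shows "graded_norm M l m (poly_act M ([:-l, 1:] ^ k) y) \<le> (\<bar>Re l\<bar> / 3) ^ k * graded_norm M l m y"
proof (induction k)
  case (Suc k)
  have "poly_act M ([:-l, 1:] ^ m) (poly_act M ([:-l, 1:] ^ k) y) = 0"
    by (subst poly_act_commute) (simp add: y)
  note graded_norm_shift[OF this m]
  also have "\<bar>Re l\<bar> / 3 * graded_norm M l m (poly_act M ([:-l, 1:] ^ k) y)
     \<le> \<bar>Re l\<bar> / 3 * ((\<bar>Re l\<bar> / 3) ^ k * graded_norm M l m y)"
    by (intro mult_left_mono Suc) auto
  finally show ?case by (simp add: poly_act_mult del: mult_pCons_left)
qed simp

section \<open>Taylor coefficients of bounded holomorphic functions\<close>

text \<open>
  The kernel is nonnegative with mean \<open>2\<close>, so for \<open>\<bar>f\<bar> \<le> 1\<close> the value of this integral is at most \<open>2\<close>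
  in modulus for every phase \<open>c\<close>.
\<close>

lemma has_integral_circlepath_kernel:
  assumes contf: "continuous_on (cball z r) f" and holf: "f holomorphic_on ball z r"
    and r: "r > 0" and k: "k > 0" and c: "norm c = 1"
  shows "((\<lambda>t. f (circlepath z r t) * of_real (2 + 2 * Re (c * cis (- (2 * pi * k * t))))) has_integral
     (2 * f z + c * r ^ k * ((deriv ^^ k) f z / fact k))) {0..1}"
proof -
  let ?g = "circlepath z r"
  have 1: "((\<lambda>u. f u / (u - z)) has_contour_integral (2 * pi * \<i>) * f z) ?g"
    using Cauchy_has_contour_integral_higher_derivative_circlepath[OF contf holf, of z 0] r by simp
  have 2: "((\<lambda>u. f u / (u - z) ^ Suc k) has_contour_integral
      (2 * pi * \<i>) / fact k * (deriv ^^ k) f z) ?g"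
    by (rule Cauchy_has_contour_integral_higher_derivative_circlepath[OF contf holf]) (use r in simp)
  \<comment> \<open>The integral is zero because f(u) (u - z)^k vanishes at u = z, which uses k >
    0.\<close>
  have 3: "((\<lambda>u. (f u * (u - z) ^ k) / (u - z)) has_contour_integral 0) ?g"
  proof -
    have "continuous_on (cball z r) (\<lambda>u. f u * (u - z) ^ k)"
      by (intro continuous_intros contf)
    moreover have "(\<lambda>u. f u * (u - z) ^ k) holomorphic_on ball z r"
      by (intro holomorphic_intros holf)
    ultimately show ?thesis
      using Cauchy_has_contour_integral_higher_derivative_circlepath[of z r "\<lambda>u. f u * (u - z) ^ k" z 0] r k
      by (simp add: zero_power)
  qed
  \<comment> \<open>On the circle u - z = r w with |w| = 1, the kernel is 2 + c w^(-k) + cnj c w^k.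
    The three summands of \<open>?F\<close> are f(u) / (u - z) times these three terms, written with
    u - z in place of w.\<close>
  let ?F = "\<lambda>u. 2 * (f u / (u - z)) + (c * r ^ k) * (f u / (u - z) ^ Suc k)
     + (cnj c / r ^ k) * ((f u * (u - z) ^ k) / (u - z))"
  have "(?F has_contour_integral (2 * ((2 * pi * \<i>) * f z) + (c * r ^ k) * ((2 * pi * \<i>) / fact k * (deriv ^^ k) f z)
     + (cnj c / r ^ k) * 0)) ?g"
    by (intro has_contour_integral_add has_contour_integral_lmul 1 2 3)
  then have "((\<lambda>t. ?F (?g t) * vector_derivative ?g (at t within {0..1})) has_integral
     (2 * ((2 * pi * \<i>) * f z) + (c * r ^ k) * ((2 * pi * \<i>) / fact k * (deriv ^^ k) f z))) {0..1}"
    by (simp add: has_contour_integral_def)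
  note integral = has_integral_mult_right[OF this, of "1 / (2 * pi * \<i>)"]
  have cancel: "1 / K * (2 * (K * x) + y * (K / w * d)) = 2 * x + y * (d / w)" if "K \<noteq> 0" for K x y w d :: complex
    using that by (simp add: distrib_left)
  have two_pi_i: "complex_of_real (2 * pi) * \<i> \<noteq> 0"
    by simp
  from integral[unfolded cancel[OF two_pi_i]]
  have "((\<lambda>t. 1 / (2 * pi * \<i>) * (?F (?g t) * vector_derivative ?g (at t within {0..1}))) has_integral
     (2 * f z + c * r ^ k * ((deriv ^^ k) f z / fact k))) {0..1}"
    .
  moreover have "1 / (2 * pi * \<i>) * (?F (?g t) * vector_derivative ?g (at t within {0..1}))
     = f (circlepath z r t) * of_real (2 + 2 * Re (c * cis (- (2 * pi * k * t))))"
     if "t \<in> {0..1}" for t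
  proof -
    define w where "w = cis (2 * pi * t)"
    have w: "w \<noteq> 0" "cnj w = inverse w" by (auto simp: w_def cis_cnj cis_inverse)
    have e: "exp (2 * of_real pi * \<i> * t) = w"
      by (simp add: w_def cis_conv_exp algebra_simps)
    have g: "?g t - z = r * w"
      by (simp add: circlepath e)
    have "inverse w ^ k = cis (real k * (- (2 * pi * t)))"
      by (simp only: w_def cis_inverse Complex.DeMoivre)
    also have "real k * (- (2 * pi * t)) = - (2 * pi * k * t)"
      by simp
    finally have "cis (- (2 * pi * k * t)) = inverse w ^ k" ..
    then have ck: "complex_of_real (2 + 2 * Re (c * cis (- (2 * pi * k * t)))) = 2 + (c * inverse w ^ k + cnj c * w ^ k)"
      using w complex_add_cnj[of "c * inverse w ^ k"] by (simp add: power_inverse)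
    have vd: "vector_derivative ?g (at t within {0..1}) = 2 * pi * \<i> * r * w"
      using that by (simp add: vector_derivative_circlepath01 e)
    show ?thesis
      unfolding ck vd g using r w(1)
      by (simp add: power_mult_distrib field_simps)
  qed
  ultimately show ?thesis
    by (rule has_integral_eq[rotated]) simp
qed

text \<open>The phase c is free in the kernel formula. Choosing it so that c a points in the
  direction of f(z), for a the Taylor coefficient, turns the modulus of the integral into 2 |f(z)| +
  r^k |a|, while nonnegativity and mean 2 of the kernel bound it by 2.\<close>

lemma taylor_coeff_bound:
  assumes contf: "continuous_on (cball z r) f" and holf: "f holomorphic_on ball z r"
    and r: "r > 0" and k: "k > 0" and bound: "\<And>w. w \<in> sphere z r \<Longrightarrow> norm (f w) \<le> 1"
  shows "norm ((deriv ^^ k) f z / fact k) * r ^ k \<le> 2 * (1 - norm (f z))"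
proof -
  define a where "a = (deriv ^^ k) f z / fact k"
  define c where "c = (if a = 0 \<or> f z = 0 then 1 else (sgn (f z) / sgn a))"
  have c: "norm c = 1" by (auto simp: c_def norm_divide norm_sgn)
  let ?K = "\<lambda>t. 2 + 2 * Re (c * cis (- (2 * pi * k * t)))"
  have K: "?K t \<ge> 0" for t
    using abs_Re_le_cmod[of "c * cis (- (2 * pi * k * t))"] by (simp add: norm_mult c)
  have I: "((\<lambda>t. f (circlepath z r t) * of_real (?K t)) has_integral (2 * f z + c * r ^ k * a)) {0..1}"
    unfolding a_def by (rule has_integral_circlepath_kernel[OF contf holf r k c])
  \<comment> \<open>The constant function 1 in the kernel formula yields the mean of the kernel,
    since its derivatives of order k > 0 vanish.\<close>
  have "((\<lambda>t. 1 * of_real (?K t)) has_integral (2 * 1 + c * r ^ k * ((deriv ^^ k) (\<lambda>_. 1) z / fact k))) {0..1}"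
    by (rule has_integral_circlepath_kernel[OF _ _ r k c]) auto
  from has_integral_Re[OF this] have J: "(?K has_integral 2) {0..1}"
    using k by (simp add: higher_deriv_const)
  have "norm (2 * f z + c * r ^ k * a) \<le> 2"
  proof -
    have "norm (integral {0..1} (\<lambda>t. f (circlepath z r t) * of_real (?K t))) \<le> integral {0..1} ?K"
    proof (rule integral_norm_bound_integral)
      fix t :: real assume "t \<in> {0..1}"
      then have "circlepath z r t \<in> sphere z r"
        using r path_image_circlepath[of z r] by (auto simp: path_image_def)
      then show "norm (f (circlepath z r t) * of_real (?K t)) \<le> ?K t"
        using bound[of "circlepath z r t"] K[of t] mult_right_mono[of "norm (f (circlepath z r t))" 1 "?K t"]
        by (simp only: norm_mult norm_of_real) auto
    qed (use I J in blast)+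
    then show ?thesis
      using integral_unique[OF I] integral_unique[OF J] by simp
  qed
  moreover have "norm (2 * f z + c * r ^ k * a) = 2 * norm (f z) + r ^ k * norm a"
  proof (cases "a = 0 \<or> f z = 0")
    case True
    then show ?thesis using r by (auto simp: norm_mult norm_power c)
  next
    case False
    have f: "f z = of_real (norm (f z)) * sgn (f z)" and a: "a = of_real (norm a) * sgn a"
      by (simp_all add: sgn_eq)
    have "c * a = sgn (f z) * of_real (norm a)"
      using False by (subst a) (simp add: c_def sgn_zero_iff)
    then have "2 * f z + c * r ^ k * a = of_real (2 * norm (f z) + r ^ k * norm a) * sgn (f z)"
      by (subst f) (simp add: algebra_simps)
    then have "norm (2 * f z + c * r ^ k * a) = \<bar>2 * norm (f z) + r ^ k * norm a\<bar>"
      using False by (simp only: norm_mult norm_of_real) (simp add: norm_sgn)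
    then show ?thesis using r by simp
  qed
  ultimately show ?thesis by (simp add: a_def mult.commute)
qed

section \<open>Bohr's inequality for P/Q and contractivity at one eigenvalue\<close>

lemma has_fps_expansion_poly: "poly p has_fps_expansion fps_of_poly (p :: complex poly)"
proof (induction p)
  case (pCons a p)
  have "(\<lambda>x. a + x * poly p x) has_fps_expansion (fps_const a + fps_X * fps_of_poly p)"
    by (intro fps_expansion_intros pCons.IH)
  moreover have "poly (pCons a p) = (\<lambda>x. a + x * poly p x)"
    by auto
  ultimately show ?case by (simp only: fps_of_poly_pCons mult.commute)
qed (auto simp: has_fps_expansion_def)

text \<open>The disc of radius |Re z0| around z0 lies in the closed left half-plane, so P/Q is
  bounded by 1 on it and the coefficient bound applies at every order. Cutting the series off at
  order m leaves an identity of polynomials, which can be applied to a matrix without any question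
  of convergence.\<close>

lemma bohr_taylor_poly:
  fixes P Q :: "complex poly"
  assumes z0: "Re z0 \<le> 0"
    and Q: "\<And>z. Re z \<le> 0 \<Longrightarrow> poly Q z \<noteq> 0"
    and PQ: "\<And>z. Re z \<le> 0 \<Longrightarrow> norm (poly P z) \<le> norm (poly Q z)"
    and m: "Re z0 = 0 \<Longrightarrow> m \<le> 1"
  obtains g S where
    "P \<circ>\<^sub>p [:z0, 1:] = (\<Sum>k<m. monom (g k) k) * (Q \<circ>\<^sub>p [:z0, 1:]) + monom 1 m * S"
    "norm (g 0) + (\<Sum>k=1..<m. norm (g k) * (\<bar>Re z0\<bar> / 3) ^ k) \<le> 1"
proof -
  define P0 where "P0 = P \<circ>\<^sub>p [:z0, 1:]"
  define Q0 where "Q0 = Q \<circ>\<^sub>p [:z0, 1:]"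
  define F where "F = fps_of_poly P0 / fps_of_poly Q0"
  define f where "f = (\<lambda>w. poly P0 w / poly Q0 w)"
  define r where "r = \<bar>Re z0\<bar>"
  have eval: "poly P0 w = poly P (z0 + w)" "poly Q0 w = poly Q (z0 + w)" for w
    by (simp_all add: P0_def Q0_def poly_pcompose)
  have Q00: "coeff Q0 0 \<noteq> 0"
    using Q[OF z0] eval(2)[of 0] by (simp add: poly_0_coeff_0)
  have F: "f has_fps_expansion F"
    unfolding f_def F_def by (intro has_fps_expansion_divide' has_fps_expansion_poly) (simp add: Q00)
  have half: "Re (z0 + w) \<le> 0" if "w \<in> cball 0 r" for w
    using that abs_Re_le_cmod[of w] z0 by (auto simp: r_def)
  have nz: "poly Q0 w \<noteq> 0" and bound: "norm (f w) \<le> 1" if "w \<in> cball 0 r" for w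
    using Q[OF half[OF that]] PQ[OF half[OF that]]
    by (auto simp: f_def eval norm_divide divide_le_eq_1)
  have g0: "fps_nth F 0 = f 0"
    using fps_nth_fps_expansion[OF F, of 0] by simp
  have coeff_bound: "norm (fps_nth F k) * r ^ k \<le> 2 * (1 - norm (fps_nth F 0))" if "r > 0" "k > 0" for k
  proof -
    have "continuous_on (cball 0 r) f" "f holomorphic_on ball 0 r"
      unfolding f_def using nz by (auto intro!: continuous_intros holomorphic_intros)
    from taylor_coeff_bound[OF this that] bound show ?thesis
      by (simp add: fps_nth_fps_expansion[OF F])
  qed
  have "norm (fps_nth F 0) + (\<Sum>k=1..<m. norm (fps_nth F k) * (r / 3) ^ k) \<le> 1"
  proof (cases "r = 0")
    \<comment> \<open>The disc is a single point here and gives no coefficient bound, but m <= 1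
      leaves only the term |g 0|.\<close>
    case True
    then have "{1..<m} = {}" using m by (simp add: r_def)
    then show ?thesis using bound[of 0] by (simp add: g0 r_def)
  next
    case False
    then have r: "r > 0" by (simp add: r_def)
    \<comment> \<open>The value 1/2 cancels the factor 2 of the coefficient bound, so the tail is at
      most 1 - |g 0|. The induction is on the exact partial sum, as the bound 1/2 alone does not
      carry over.\<close>
    have geo: "(\<Sum>k=1..<m. (1/3::real) ^ k) \<le> 1 / 2"
    proof -
      have "(\<Sum>k=1..<m. (1/3::real) ^ k) \<le> 1 / 2 - 3 / 2 * (1/3) ^ m" if "m > 0"
        using that by (induction m rule: nat_induct_non_zero) auto
      moreover have "(0::real) \<le> 3 / 2 * (1/3) ^ m" by simp
      ultimately show ?thesis by (cases "m = 0") (simp, linarith)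
    qed
    have "(\<Sum>k=1..<m. norm (fps_nth F k) * (r / 3) ^ k)
       \<le> (\<Sum>k=1..<m. 2 * (1 - norm (fps_nth F 0)) * (1/3) ^ k)"
    proof (rule sum_mono)
      fix k assume "k \<in> {1..<m}"
      then have "norm (fps_nth F k) * r ^ k * (1/3) ^ k \<le> 2 * (1 - norm (fps_nth F 0)) * (1/3) ^ k"
        using coeff_bound[OF r, of k] by (intro mult_right_mono) auto
      then show "norm (fps_nth F k) * (r / 3) ^ k \<le> 2 * (1 - norm (fps_nth F 0)) * (1/3) ^ k"
        by (simp add: power_divide)
    qed
    also have "\<dots> = 2 * (1 - norm (fps_nth F 0)) * (\<Sum>k=1..<m. (1/3) ^ k)"
      by (simp add: sum_distrib_left)
    also have "\<dots> \<le> 2 * (1 - norm (fps_nth F 0)) * (1 / 2)"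
      using bound[of 0] r by (intro mult_left_mono geo) (auto simp: g0)
    finally show ?thesis by simp
  qed
  \<comment> \<open>Divisibility by x^m means agreement of the coefficients below m. There the
    truncation of F does not show, and F Q0 = P0 holds because Q0, with nonzero constant term, is a
    unit among the power series.\<close>
  moreover have "monom 1 m dvd P0 - (\<Sum>k<m. monom (fps_nth F k) k) * Q0"
    unfolding monom_1_dvd_iff'
  proof (intro allI impI)
    fix n assume n: "n < m"
    have "F * fps_of_poly Q0 = fps_of_poly P0"
      unfolding F_def by (rule dvd_div_mult_self) (simp add: fps_dvd_iff Q00)
    then have "coeff P0 n = fps_nth (F * fps_of_poly Q0) n"
      by simp
    also have "\<dots> = (\<Sum>i\<le>n. fps_nth F i * coeff Q0 (n - i))"
      by (simp add: fps_mult_nth atLeast0AtMost)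
    also have "\<dots> = coeff ((\<Sum>k<m. monom (fps_nth F k) k) * Q0) n"
      using n by (auto simp: coeff_mult coeff_sum intro!: sum.cong)
    finally show "coeff (P0 - (\<Sum>k<m. monom (fps_nth F k) k) * Q0) n = 0"
      by simp
  qed
  then obtain S where "P0 = (\<Sum>k<m. monom (fps_nth F k) k) * Q0 + monom 1 m * S"
    by (metis dvdE add.commute diff_add_cancel)
  ultimately show thesis
    using that unfolding P0_def Q0_def r_def by blast
qed

text \<open>Comparing numerator and denominator on the same w avoids inverting Q(hM). With y = Q(hM)
  w and N = M - l, the expansion at hl gives P(hM) w as the sum of g_k (hN)^k y, the remainder being
  killed by N^m w = 0. The norm of N^k y is at most (|Re l| / 3)^k times that of y, so the weighted
  coefficient sum is the one bounded by 1.\<close>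

lemma graded_norm_contractive:
  fixes P Q :: "complex poly"
  assumes y: "poly_act M ([:-l, 1:] ^ m) w = 0" and m: "Re l = 0 \<Longrightarrow> m \<le> 1"
    and l: "Re l \<le> 0" and h: "h > 0"
    and Q: "\<And>z. Re z \<le> 0 \<Longrightarrow> poly Q z \<noteq> 0"
    and PQ: "\<And>z. Re z \<le> 0 \<Longrightarrow> norm (poly P z) \<le> norm (poly Q z)"
  shows "graded_norm M l m (poly_act M (P \<circ>\<^sub>p [:0, of_real h:]) w)
      \<le> graded_norm M l m (poly_act M (Q \<circ>\<^sub>p [:0, of_real h:]) w)"
proof (cases "m = 0")
  case True
  then show ?thesis by (simp add: graded_norm_def)
next
  case False
  define z0 where "z0 = of_real h * l"
  \<comment> \<open>Substituting h (x - l) for the local variable turns z0 + x into h x, so the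
    expansion around z0 becomes one in powers of x - l.\<close>
  define L where "L = smult (of_real h) [:-l, 1:]"
  have z0: "Re z0 \<le> 0" "Re z0 = 0 \<Longrightarrow> m \<le> 1" "\<bar>Re z0\<bar> = h * \<bar>Re l\<bar>"
    using l h m by (auto simp: z0_def mult_nonneg_nonpos abs_mult)
  obtain g S where
    gS: "P \<circ>\<^sub>p [:z0, 1:] = (\<Sum>k<m. monom (g k) k) * (Q \<circ>\<^sub>p [:z0, 1:]) + monom 1 m * S" and
    g: "norm (g 0) + (\<Sum>k=1..<m. norm (g k) * (\<bar>Re z0\<bar> / 3) ^ k) \<le> 1"
    by (rule bohr_taylor_poly[OF z0(1) Q PQ z0(2)]) (assumption | rule that)+
  have shift: "p \<circ>\<^sub>p [:z0, 1:] \<circ>\<^sub>p L = p \<circ>\<^sub>p [:0, of_real h:]" for p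
    by (simp add: pcompose_assoc[symmetric] pcompose_pCons L_def z0_def)
  have monom_comp: "monom c k \<circ>\<^sub>p L = smult (c * of_real h ^ k) ([:-l, 1:] ^ k)" for c k
  proof -
    have "monom c k \<circ>\<^sub>p L = smult c (L ^ k)"
      by (induction k) (auto simp: monom_0 monom_Suc pcompose_pCons)
    then show ?thesis by (simp only: L_def smult_power smult_smult)
  qed
  define y where "y = poly_act M (Q \<circ>\<^sub>p [:0, of_real h:]) w"
  have y0: "poly_act M ([:-l, 1:] ^ m) y = 0"
    unfolding y_def by (subst poly_act_commute) (simp add: y)
  have "P \<circ>\<^sub>p [:0, of_real h:] =
     (\<Sum>k<m. smult (g k * of_real h ^ k) ([:-l, 1:] ^ k)) * (Q \<circ>\<^sub>p [:0, of_real h:])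
       + (S \<circ>\<^sub>p L) * smult (of_real h ^ m) ([:-l, 1:] ^ m)"
    using arg_cong[OF gS, of "\<lambda>p. p \<circ>\<^sub>p L"]
    by (simp add: shift pcompose_add pcompose_mult pcompose_sum monom_comp mult.commute)
  then have "poly_act M (P \<circ>\<^sub>p [:0, of_real h:]) w =
       (\<Sum>k<m. (g k * of_real h ^ k) *s poly_act M ([:-l, 1:] ^ k) y)"
    by (simp add: poly_act_add poly_act_mult poly_act_sum poly_act_smult y y_def)
  then have "graded_norm M l m (poly_act M (P \<circ>\<^sub>p [:0, of_real h:]) w) \<le>
      (\<Sum>k<m. norm (g k * of_real h ^ k) * graded_norm M l m (poly_act M ([:-l, 1:] ^ k) y))"
    using graded_norm_sum[of M l m _ "{..<m}"] by (simp add: graded_norm_smult[symmetric])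
  also have "\<dots> \<le> (\<Sum>k<m. norm (g k * of_real h ^ k) * ((\<bar>Re l\<bar> / 3) ^ k * graded_norm M l m y))"
    by (intro sum_mono mult_left_mono graded_norm_power y0 m) auto
  also have "\<dots> = (\<Sum>k<m. norm (g k) * (\<bar>Re z0\<bar> / 3) ^ k) * graded_norm M l m y"
    unfolding sum_distrib_right z0(3) using h
    by (intro sum.cong) (auto simp: norm_mult norm_power power_divide power_mult_distrib)
  also have "\<dots> \<le> 1 * graded_norm M l m y"
  proof (rule mult_right_mono)
    have "{..<m} = insert 0 {1..<m}" using False by auto
    then show "(\<Sum>k<m. norm (g k) * (\<bar>Re z0\<bar> / 3) ^ k) \<le> 1" using g by simp
  qed (rule graded_norm_nonneg)
  finally show ?thesis by (simp add: y_def)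
qed

section \<open>Stable linear equations\<close>

definition cvec :: "real^'n \<Rightarrow> complex^'n" where
  "cvec x = (\<chi> i. of_real (x $ i))"

definition cmat :: "real^'n^'n \<Rightarrow> complex^'n^'n" where
  "cmat A = map_matrix of_real A"

lemma cvec_0 [simp]: "cvec 0 = 0"
  by (simp add: cvec_def vec_eq_iff)

lemma cvec_eq_0_iff [simp]: "cvec x = 0 \<longleftrightarrow> x = 0"
  by (simp add: cvec_def vec_eq_iff)

lemma cvec_add: "cvec (x + y) = cvec x + cvec y"
  by (simp add: cvec_def vec_eq_iff)

lemma cvec_smult: "cvec (c *s x) = of_real c *s cvec x"
  by (simp add: cvec_def vec_eq_iff)

lemma cvec_scaleR: "cvec (c *\<^sub>R x) = c *\<^sub>R cvec x"
  by (simp add: cvec_def vec_eq_iff scaleR_conv_of_real[where 'a = complex])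

lemma cmat_mult_cvec: "cmat A *v cvec x = cvec (A *v x)"
  by (simp add: cvec_def cmat_def vec_eq_iff matrix_vector_mult_def)

lemma cvec_poly_act: "cvec (poly_act A p x) = poly_act (cmat A) (map_poly of_real p) (cvec x)"
  by (induction p) (auto simp: map_poly_pCons cvec_add cvec_smult simp flip: cmat_mult_cvec)

lemma poly_matrix_mult_vec: "poly_matrix p M *v x = poly_act M p x"
proof -
  have pow: "((\<lambda>N. M ** N) ^^ k) (mat 1) *v x = ((*v) M ^^ k) x" for k
    by (induction k) (auto simp flip: matrix_vector_mul_assoc)
  have "(\<Sum>k\<in>S. coeff p k *\<^sub>R ((\<lambda>N. M ** N) ^^ k) (mat 1)) *v x =
      (\<Sum>k\<in>S. coeff p k *s ((*v) M ^^ k) x)" for S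
    by (induction S rule: infinite_finite_induct)
       (auto simp: matrix_vector_mult_add_rdistrib pow scalar_mult_eq_scaleR simp flip: scaleR_matrix_vector_assoc)
  then show ?thesis by (simp add: poly_matrix_def poly_act_def)
qed

lemma cvec_poly_matrix:
  "cvec (poly_matrix p (h *\<^sub>R A) *v x) = poly_act (cmat A) (map_poly of_real p \<circ>\<^sub>p [:0, of_real h:]) (cvec x)"
proof -
  have "cmat (h *\<^sub>R A) = map_matrix ((*) (of_real h)) (cmat A)"
    by (simp add: cmat_def vec_eq_iff)
  then show ?thesis
    by (simp add: poly_matrix_mult_vec cvec_poly_act poly_act_pcompose_scale)
qed

section \<open>What bounded solutions imply for the spectrum\<close>

text \<open>Stability is assumed for real solutions, but eigenvectors are complex. As A is real, the
  real and imaginary parts of a complex solution solve the equation separately.\<close>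

lemma complex_solution_bounded:
  assumes A: "stable_ode A"
    and z: "\<And>t. (z has_vector_derivative cmat A *v z t) (at t)"
  shows "bounded (z ` {0..})"
proof -
  have re: "linear (\<lambda>x :: complex^'n. (\<chi> i. Re (x $ i)) :: real^'n)"
    and im: "linear (\<lambda>x :: complex^'n. (\<chi> i. Im (x $ i)) :: real^'n)"
    by (rule linearI; simp add: vec_eq_iff)+
  have "bounded ((\<lambda>t. \<chi> i. Re (z t $ i)) ` {0..})" (is "bounded (?r ` _)")
  proof -
    have "(\<chi> i. Re ((cmat A *v z t) $ i)) = A *v (\<chi> i. Re (z t $ i))" for t
      by (simp add: cmat_def vec_eq_iff matrix_vector_mult_def)
    then have "ode_solution A ?r"
      using bounded_linear.has_vector_derivative[OF re[unfolded linear_conv_bounded_linear] has_vector_derivative_at_within[OF z]]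
      by (auto simp: ode_solution_def)
    with A show ?thesis by (simp add: stable_ode_def)
  qed
  then obtain B where B: "\<And>t. t \<ge> 0 \<Longrightarrow> norm (?r t) \<le> B"
    by (auto simp: bounded_iff)
  have "bounded ((\<lambda>t. \<chi> i. Im (z t $ i)) ` {0..})" (is "bounded (?i ` _)")
  proof -
    have "(\<chi> i. Im ((cmat A *v z t) $ i)) = A *v (\<chi> i. Im (z t $ i))" for t
      by (simp add: cmat_def vec_eq_iff matrix_vector_mult_def)
    then have "ode_solution A ?i"
      using bounded_linear.has_vector_derivative[OF im[unfolded linear_conv_bounded_linear] has_vector_derivative_at_within[OF z]]
      by (auto simp: ode_solution_def)
    with A show ?thesis by (simp add: stable_ode_def)
  qed
  then obtain C where C: "\<And>t. t \<ge> 0 \<Longrightarrow> norm (?i t) \<le> C"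
    by (auto simp: bounded_iff)
  have "norm (z t) \<le> B + C" if "t \<ge> 0" for t
  proof -
    have "norm (z t) \<le> L2_set (\<lambda>i. norm (?r t $ i) + norm (?i t $ i)) UNIV"
      unfolding norm_vec_def by (rule L2_set_mono) (auto simp: cmod_le)
    also have "\<dots> \<le> norm (?r t) + norm (?i t)"
      unfolding norm_vec_def by (rule L2_set_triangle_ineq)
    finally show ?thesis using B[OF that] C[OF that] by linarith
  qed
  then show ?thesis by (auto simp: bounded_iff)
qed

text \<open>The function exp(l t) (w + t v) solves the equation. Taking v = 0 makes w an eigenvector
  and controls the sign of Re l; taking Re l = 0 excludes the linear growth of a genuine
  chain.\<close>

lemma jordan_chain_bounded:
  assumes A: "stable_ode A" and v: "cmat A *v v = l *s v" and w: "cmat A *v w = l *s w + v"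
  shows "\<exists>B. \<forall>t\<ge>0. exp (Re l * t) * norm (w + of_real t *s v) \<le> B"
proof -
  define z where "z = (\<lambda>t. exp (l * of_real t) *s w + (of_real t * exp (l * of_real t)) *s v)"
  have lin: "bounded_linear (\<lambda>c :: complex. c *s (x :: complex^'a))" for x
    unfolding linear_conv_bounded_linear[symmetric]
    by (rule linearI) (simp_all add: vec_eq_iff algebra_simps)
  have 1: "((\<lambda>t. exp (l * of_real t)) has_vector_derivative l * exp (l * of_real t)) (at t)" for t :: real
    by (rule has_vector_derivative_real_field) (auto intro!: derivative_eq_intros)
  have 2: "((\<lambda>t. of_real t * exp (l * of_real t)) has_vector_derivative
       exp (l * of_real t) + of_real t * (l * exp (l * of_real t))) (at t)" for t :: real
    by (rule has_vector_derivative_real_field) (auto intro!: derivative_eq_intros)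
  have "(z has_vector_derivative cmat A *v z t) (at t)" for t
  proof -
    have "(z has_vector_derivative (l * exp (l * of_real t)) *s w +
        (exp (l * of_real t) + of_real t * (l * exp (l * of_real t))) *s v) (at t)"
      unfolding z_def
      by (intro has_vector_derivative_add bounded_linear.has_vector_derivative[OF lin] 1 2)
    also have "(l * exp (l * of_real t)) *s w +
        (exp (l * of_real t) + of_real t * (l * exp (l * of_real t))) *s v = cmat A *v z t"
      by (simp add: z_def matrix_vector_right_distrib vector_scalar_commute v w)
         (simp add: vec_eq_iff algebra_simps)
    finally show ?thesis .
  qed
  then have "bounded (z ` {0..})" by (rule complex_solution_bounded[OF A])
  moreover have "norm (z t) = exp (Re l * t) * norm (w + of_real t *s v)" for t
  proof -
    have "z t = exp (l * of_real t) *s (w + of_real t *s v)"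
      by (simp add: z_def vec_eq_iff algebra_simps)
    then have "norm (z t) = norm (exp (l * of_real t)) * norm (w + of_real t *s v)"
      by (simp only: norm_vector_smult)
    then show ?thesis by simp
  qed
  ultimately show ?thesis by (auto simp: bounded_iff)
qed

lemma stable_ode_eigenvalue:
  assumes A: "stable_ode A" and v: "cmat A *v v = l *s v" "v \<noteq> 0"
  shows "Re l \<le> 0"
proof (rule ccontr)
  assume l: "\<not> Re l \<le> 0"
  obtain B where B: "\<And>t. t \<ge> 0 \<Longrightarrow> exp (Re l * t) * norm v \<le> B"
    using jordan_chain_bounded[OF A, of 0 l v] v by auto
  \<comment> \<open>Then Re l * t * |v| = |B|, so the estimate 1 + x <= exp x already exceeds
    B.\<close>
  define t where "t = \<bar>B\<bar> / (Re l * norm v)"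
  have t: "t \<ge> 0" using l by (simp add: t_def)
  have "B < (1 + Re l * t) * norm v"
    using l v by (simp add: t_def field_simps) (smt (verit) zero_less_norm_iff)
  also have "\<dots> \<le> exp (Re l * t) * norm v"
    by (intro mult_right_mono) auto
  finally show False using B[OF t] by simp
qed

lemma stable_ode_semisimple:
  assumes A: "stable_ode A" and l: "Re l = 0"
    and v: "cmat A *v v = l *s v" and w: "cmat A *v w = l *s w + v"
  shows "v = 0"
proof (rule ccontr)
  assume nz: "v \<noteq> 0"
  obtain B where B: "\<And>t. t \<ge> 0 \<Longrightarrow> norm (w + of_real t *s v) \<le> B"
    using jordan_chain_bounded[OF A v w] l by auto
  \<comment> \<open>This makes |t v| larger than B + |w|, against the triangle inequality.\<close>
  define t where "t = (\<bar>B\<bar> + norm w + 1) / norm v"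
  have t: "t \<ge> 0" by (simp add: t_def)
  have "norm (of_real t *s v) = \<bar>B\<bar> + norm w + 1"
    using nz t by (simp add: norm_vector_smult) (simp add: t_def)
  moreover have "norm (of_real t *s v) \<le> norm (w + of_real t *s v) + norm w"
    using norm_triangle_ineq4[of "w + of_real t *s v" w] by simp
  ultimately show False using B[OF t] by linarith
qed

text \<open>For an annihilating polynomial of least degree, removing one linear factor z - l leaves
  a polynomial that does not annihilate, and its nonzero values are eigenvectors for l. So every
  root is an eigenvalue, and a double root yields a Jordan chain of length two.\<close>

lemma stable_ode_minimal_poly:
  assumes A: "stable_ode A"
  obtains p where "p \<noteq> 0" "\<And>x. poly_act (cmat A) p x = 0"
    "\<And>l. poly p l = 0 \<Longrightarrow> Re l \<le> 0" "\<And>l. Re l = 0 \<Longrightarrow> order l p \<le> 1"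
proof -
  obtain p0 where "p0 \<noteq> 0" "\<And>x. poly_act (cmat A) p0 x = 0"
    using matrix_annihilating_poly[of "cmat A"] by blast
  then obtain p where p: "p \<noteq> 0" "\<And>x. poly_act (cmat A) p x = 0"
    and min: "\<And>r. r \<noteq> 0 \<Longrightarrow> \<forall>x. poly_act (cmat A) r x = 0 \<Longrightarrow> degree p \<le> degree r"
    using least_degree_poly[of p0 "\<lambda>p. \<forall>x. poly_act (cmat A) p x = 0"] by metis
  have cofactor: "\<exists>x. poly_act (cmat A) q x \<noteq> 0 \<and> cmat A *v poly_act (cmat A) q x = l *s poly_act (cmat A) q x"
    if q: "p = [:-l, 1:] * q" for l q
  proof -
    have "q \<noteq> 0" using q p by auto
    then have "degree p = Suc (degree q)"
      by (simp add: q degree_mult_eq del: mult_pCons_left)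
    with min[of q] \<open>q \<noteq> 0\<close> obtain x where "poly_act (cmat A) q x \<noteq> 0"
      by fastforce
    moreover have "cmat A *v poly_act (cmat A) q x = l *s poly_act (cmat A) q x"
      using p(2)[of x] unfolding q poly_act_mult poly_act_linear_factor by simp
    ultimately show ?thesis by blast
  qed
  show thesis
  proof (rule that[OF p])
    fix l assume "poly p l = 0"
    then obtain q where "p = [:-l, 1:] * q" by (auto simp: poly_eq_0_iff_dvd)
    then show "Re l \<le> 0" using cofactor stable_ode_eigenvalue[OF A] by blast
  next
    fix l assume l: "Re l = 0"
    show "order l p \<le> 1"
    proof (rule ccontr)
      assume "\<not> order l p \<le> 1"
      then have "[:-l, 1:] ^ 2 dvd p" by (simp add: order_divides)
      then obtain q where q: "p = [:-l, 1:] * ([:-l, 1:] * q)"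
        by (metis dvdE power2_eq_square mult.assoc)
      then obtain x where x: "poly_act (cmat A) ([:-l, 1:] * q) x \<noteq> 0"
        "cmat A *v poly_act (cmat A) ([:-l, 1:] * q) x = l *s poly_act (cmat A) ([:-l, 1:] * q) x"
        using cofactor by blast
      \<comment> \<open>The chain consists of w = q(A) x and v = (A - l) w, where v is the
        eigenvector just obtained.\<close>
      moreover have "cmat A *v poly_act (cmat A) q x =
          l *s poly_act (cmat A) q x + poly_act (cmat A) ([:-l, 1:] * q) x"
        unfolding poly_act_mult poly_act_linear_factor by simp
      ultimately show False using stable_ode_semisimple[OF A l] by blast
    qed
  qed
qed

section \<open>The weight matrix and the inverse of the denominator\<close>

lemma poly_act_vec_scaleR: "poly_act M p (c *\<^sub>R x) = c *\<^sub>R poly_act M p (x :: complex^'n)"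
proof -
  have "c *\<^sub>R z = of_real c *s z" for z :: "complex^'n"
    by (simp add: vec_eq_iff scaleR_conv_of_real[where 'a = complex])
  then show ?thesis by (simp add: poly_act_vec_smult)
qed

text \<open>The matrix is the sum of the products of the adjoint of L i with L i. Complex target
  spaces are taken as real Euclidean spaces, which makes the resulting matrix real.\<close>

lemma sum_squares_matrix:
  fixes L :: "'i \<Rightarrow> real^'n \<Rightarrow> 'b::euclidean_space"
  assumes L: "\<And>i. i \<in> I \<Longrightarrow> linear (L i)"
  obtains W where "transpose W = W" "\<And>y. y \<bullet> (W *v y) = (\<Sum>i\<in>I. (norm (L i y))\<^sup>2)"
proof -
  define W where "W = matrix (\<lambda>y. \<Sum>i\<in>I. adjoint (L i) (L i y))"
  have "linear (\<lambda>y. \<Sum>i\<in>I. adjoint (L i) (L i y))"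
    using linear_compose[OF L adjoint_linear[OF L]] by (intro linear_compose_sum) (auto simp: o_def)
  then have "W *v y = (\<Sum>i\<in>I. adjoint (L i) (L i y))" for y
    unfolding W_def by (intro matrix_works) (simp add: linear_matrix_vector_mul_eq)
  then have inner: "x \<bullet> (W *v y) = (\<Sum>i\<in>I. L i x \<bullet> L i y)" for x y
    by (simp add: inner_sum_right adjoint_works L)
  have "x \<bullet> (transpose W *v y) = x \<bullet> (W *v y)" for x y
  proof -
    have "x \<bullet> (transpose W *v y) = y \<bullet> (W *v x)"
      by (simp add: transpose_matrix_vector dot_lmul_matrix inner_commute[of x])
    then show ?thesis by (simp add: inner inner_commute)
  qed
  then have "transpose W *v y = W *v y" for y
    by (metis vector_eq_ldot)
  then have "transpose W = W" by (simp add: matrix_eq)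
  then show thesis using inner by (intro that) (auto simp: power2_norm_eq_inner)
qed

lemma graded_norm_eq_0D:
  assumes "graded_norm M l m y = 0" "m > 0"
  shows "y = 0"
proof -
  have "(3 / \<bar>Re l\<bar>) ^ 0 * norm (poly_act M ([:-l, 1:] ^ 0) y) \<le> graded_norm M l m y"
    unfolding graded_norm_def by (rule member_le_L2_set) (use assms in auto)
  then show ?thesis using assms by simp
qed

text \<open>A nonzero kernel vector of Q(hA) would have an eigenvector of A in its orbit, which
  Q(hA) also kills. Its eigenvalue l would then give Q(hl) = 0 with Re (hl) <= 0.\<close>

lemma stable_ode_poly_matrix_inv:
  assumes A: "stable_ode A" and h: "h > 0"
    and Q: "\<And>z. Re z \<le> 0 \<Longrightarrow> poly (map_poly of_real Q) z \<noteq> (0 :: complex)"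
  shows "poly_matrix Q (h *\<^sub>R A) *v (matrix_inv (poly_matrix Q (h *\<^sub>R A)) *v x) = x"
proof -
  let ?M = "cmat A" and ?Q = "map_poly of_real Q \<circ>\<^sub>p [:0, of_real h:] :: complex poly"
  have "x = 0" if "poly_matrix Q (h *\<^sub>R A) *v x = 0" for x
  proof (rule ccontr)
    assume "x \<noteq> 0"
    then obtain p l where pl: "poly_act ?M p (cvec x) \<noteq> 0"
      "?M *v poly_act ?M p (cvec x) = l *s poly_act ?M p (cvec x)"
      using eigenvector_in_orbit[of "cvec x" ?M] by auto
    have "poly_act ?M p (poly_act ?M ?Q (cvec x)) = 0"
      using that by (simp flip: cvec_poly_matrix)
    then have "poly ?Q l *s poly_act ?M p (cvec x) = 0"
      using poly_act_eigenvector[OF pl(2), of ?Q] by (simp add: poly_act_commute)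
    then have "poly (map_poly of_real Q) (of_real h * l) = (0 :: complex)"
      using pl(1) by (simp add: poly_pcompose mult.commute)
    moreover have "Re (of_real h * l) \<le> 0"
      using stable_ode_eigenvalue[OF A pl(2,1)] h by (simp add: mult_nonneg_nonpos)
    ultimately show False using Q by blast
  qed
  then have "invertible (poly_matrix Q (h *\<^sub>R A))"
    unfolding invertible_left_inverse matrix_left_invertible_ker by blast
  then have "poly_matrix Q (h *\<^sub>R A) ** matrix_inv (poly_matrix Q (h *\<^sub>R A)) = mat 1"
    unfolding invertible_def matrix_inv_def by (rule someI2_ex) blast
  then show ?thesis
    by (simp add: matrix_vector_mul_assoc)
qed

theorem theorem1:
  fixes a :: "real^'s^'s" and b :: "real^'s" and A :: "real^'d^'d"
  assumes "A_stable (stability_function a b)"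
    and "stable_ode A"
  shows "\<exists>W :: real^'d^'d. sym_pos_def W \<and>
    (\<forall>(h :: nat \<Rightarrow> real) (y :: nat \<Rightarrow> real^'d) (y' :: nat \<Rightarrow> real^'d).
       (\<forall>n. h n > 0) \<longrightarrow>
       numerical_solution (stability_function a b) A h y \<longrightarrow>
       numerical_solution (stability_function a b) A h y' \<longrightarrow>
       (\<forall>n. weighted_norm W (y (Suc n) - y' (Suc n)) \<le> weighted_norm W (y n - y' n)))"
proof -
  define R where "R = stability_function a b"
  define P where "P = (map_poly of_real (fract_num R) :: complex poly)"
  define Q where "Q = (map_poly of_real (fract_denom R) :: complex poly)"
  have R: "A_stable R" using assms(1) by (simp add: R_def)
  have Q: "poly Q z \<noteq> 0" if "Re z \<le> 0" for z
    using R that by (auto simp: A_stable_def fract_poles_def Q_def)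
  have PQ: "norm (poly P z) \<le> norm (poly Q z)" if "Re z \<le> 0" for z
    using R that Q[OF that]
    by (auto simp: A_stable_def eval_fract_def norm_divide P_def[symmetric] Q_def[symmetric] divide_le_eq_1)

  let ?M = "cmat A"
  obtain p where p: "p \<noteq> 0" "\<And>x. poly_act ?M p x = 0"
    and Re: "\<And>l. poly p l = 0 \<Longrightarrow> Re l \<le> 0" and ord: "\<And>l. Re l = 0 \<Longrightarrow> order l p \<le> 1"
    using stable_ode_minimal_poly[OF assms(2)] by blast
  define E where "E = {l. poly p l = 0}"
  have fin: "finite E" unfolding E_def by (rule poly_roots_finite[OF p(1)])
  \<comment> \<open>Since p annihilates, q_l(A) maps every vector into the kernel of (A - l)^(order
    l p), where the norm for l is contractive.\<close>
  have "\<exists>q. p = [:-l, 1:] ^ order l p * q \<and> \<not> [:-l, 1:] dvd q" for l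
    by (rule order_decomp[OF p(1)])
  then obtain q where q: "\<And>l. p = [:-l, 1:] ^ order l p * q l" "\<And>l. poly (q l) l \<noteq> 0"
    unfolding poly_eq_0_iff_dvd by metis
  define G where "G = (\<lambda>x. \<Sum>l\<in>E. (graded_norm ?M l (order l p) (poly_act ?M (q l) x))\<^sup>2)"
  \<comment> \<open>These are the single terms under the squares in \<open>G\<close>, as real linear
    maps indexed by eigenvalue and power; they exhibit \<open>G\<close> as a real quadratic
    form.\<close>
  define L where "L = (\<lambda>(l, k) y. (3 / \<bar>Re l\<bar>) ^ k *\<^sub>R poly_act ?M ([:-l, 1:] ^ k) (poly_act ?M (q l) (cvec y)))"
  have G_pos: "G (cvec x) > 0" if "x \<noteq> 0" for x
  proof (rule ccontr)
    assume "\<not> G (cvec x) > 0"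
    moreover have "G (cvec x) \<ge> 0" unfolding G_def by (intro sum_nonneg) auto
    ultimately have "G (cvec x) = 0" by linarith
    then have "graded_norm ?M l (order l p) (poly_act ?M (q l) (cvec x)) = 0" if "l \<in> E" for l
      using that fin unfolding G_def by (subst (asm) sum_nonneg_eq_0_iff) auto
    note gn = this
    have zero: "poly_act ?M (q l) (cvec x) = 0" if "l \<in> E" for l
      \<comment> \<open>A root has positive order, so the term k = 0 is present and detects the
        vector.\<close>
      by (rule graded_norm_eq_0D[OF gn[OF that]]) (use that p(1) order_root[of p l] in \<open>auto simp: E_def\<close>)
    obtain r l where rl: "poly_act ?M r (cvec x) \<noteq> 0"
      "?M *v poly_act ?M r (cvec x) = l *s poly_act ?M r (cvec x)"
      using eigenvector_in_orbit[of "cvec x" ?M] \<open>x \<noteq> 0\<close> by auto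
    have "poly p l *s poly_act ?M r (cvec x) = 0"
      using poly_act_eigenvector[OF rl(2), of p] p(2) by simp
    then have "l \<in> E" using rl(1) by (simp add: E_def)
    \<comment> \<open>On the eigenvector r(A) x the polynomial q_l acts as the nonzero scalar
      q_l(l), yet q_l(A) x = 0.\<close>
    have "poly (q l) l *s poly_act ?M r (cvec x) = poly_act ?M r (poly_act ?M (q l) (cvec x))"
      using poly_act_eigenvector[OF rl(2), of "q l"] by (simp add: poly_act_commute)
    then show False using zero[OF \<open>l \<in> E\<close>] rl(1) q(2)[of l] by simp
  qed
  have G_contr: "G (cvec (poly_matrix (fract_num R) (h *\<^sub>R A) *v u))
      \<le> G (cvec (poly_matrix (fract_denom R) (h *\<^sub>R A) *v u))" if h: "h > 0" for h u
    unfolding G_def cvec_poly_matrix P_def[symmetric] Q_def[symmetric]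
  proof (intro sum_mono power_mono graded_norm_nonneg)
    fix l assume l: "l \<in> E"
    have "poly_act ?M ([:-l, 1:] ^ order l p) (poly_act ?M (q l) (cvec u)) = 0"
      using p(2) q(1)[of l] by (metis poly_act_mult)
    from graded_norm_contractive[OF this ord Re h Q PQ] l
    show "graded_norm ?M l (order l p) (poly_act ?M (q l) (poly_act ?M (P \<circ>\<^sub>p [:0, of_real h:]) (cvec u)))
      \<le> graded_norm ?M l (order l p) (poly_act ?M (q l) (poly_act ?M (Q \<circ>\<^sub>p [:0, of_real h:]) (cvec u)))"
      by (simp add: E_def poly_act_commute[of _ "q l"])
  qed

  have "linear (L i)" for i
    by (cases i, rule linearI) (auto simp: L_def cvec_add cvec_scaleR poly_act_vec_add poly_act_vec_scaleR scaleR_add_right)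
  then obtain W where W: "transpose W = W"
    "\<And>y. y \<bullet> (W *v y) = (\<Sum>i\<in>Sigma E (\<lambda>l. {..<order l p}). (norm (L i y))\<^sup>2)"
    using sum_squares_matrix[of "Sigma E (\<lambda>l. {..<order l p})" L] by blast
  have WG: "y \<bullet> (W *v y) = G (cvec y)" for y
  proof -
    have "(graded_norm ?M l (order l p) (poly_act ?M (q l) (cvec y)))\<^sup>2 =
        (\<Sum>k<order l p. (norm (L (l, k) y))\<^sup>2)" for l
      by (simp add: L_def graded_norm_def L2_set_def sum_nonneg power_mult_distrib)
    then show ?thesis
      by (simp add: W(2) G_def sum.Sigma fin split_def)
  qed
  show ?thesis
  proof (intro exI[of _ W] conjI allI impI)
    show "sym_pos_def W" using W(1) G_pos by (auto simp: sym_pos_def_def WG)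
  next
    fix h y y' n
    assume h: "\<forall>n. h n > (0 :: real)"
      and y: "numerical_solution (stability_function a b) A h y"
      and y': "numerical_solution (stability_function a b) A h y'"
    let ?N = "poly_matrix (fract_num R) (h n *\<^sub>R A)" and ?D = "poly_matrix (fract_denom R) (h n *\<^sub>R A)"
    \<comment> \<open>With u the preimage of the old difference under the denominator, the new
      difference is the numerator applied to u, and the comparison of numerator and denominator
      applies.\<close>
    define u where "u = matrix_inv ?D *v (y n - y' n)"
    have "y (Suc n) - y' (Suc n) = ?N *v u"
      using y y' unfolding numerical_solution_def R_def[symmetric]
      by (simp add: fract_matrix_def u_def matrix_vector_mult_diff_distrib flip: matrix_vector_mul_assoc)
    moreover have "y n - y' n = ?D *v u"
      unfolding u_def using h Q unfolding Q_def
      by (intro stable_ode_poly_matrix_inv[OF assms(2), symmetric]) auto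
    ultimately show "weighted_norm W (y (Suc n) - y' (Suc n)) \<le> weighted_norm W (y n - y' n)"
      using G_contr[of "h n" u] h by (simp add: weighted_norm_def WG)
  qed
qed

end
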